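(* For any shape $S\in\mathcal C_k$ on $n$ nodes, the adjacency closure $AC(S)$ can be grown from a single node in $O(k\log n)$ time steps by a cycle-preserving growth process in the adjacency graph model.
   Context: Shapes. Grid points are integer pairs $(x,y)$; two grid points are adjacent if they are at orthogonal (Manhattan) distance $1$. A shape $S=(V,E)$ is a finite connected graph whose nodes occupy distinct grid points and whose edges join only pairs of nodes occupying adjacent points; shapes are considered up to translation, and $n=|V|$. The adjacency closure $AC(S)$ is obtained from $S$ by adding an edge between every pair of adjacent nodes that are not yet joined. Growth operations. One node, the anchor $u_0$, is stationary; other nodes move relative to it. A growth operation on a node $u$ toward an adjacent grid point $p$ either (i) if $u$ has no edge to $p$, creates a new node $u'$ at $p$ with edge $uu'$; or (ii) if $p$ is occupied by a node $v$ with $uv\in E$, creates a new node $u'$ at $p$, replaces edge $uv$ by edges $uu',u'v$, and translates by one unit, along the axis of $uv$, the part of a spanning tree rooted at $u_0$ hanging from whichever of $u,v$ is farther from $u_0$, away from the other endpoint. In one time step a set of operations is applied concurrently, each node receiving at most one operation and all operations having the same cardinal direction; the displacement of each node is the sum of the unit vectors contributed by the operations on its path to $u_0$ in a spanning tree rooted at $u_0$. The set is collision-free if no two nodes collide during these motions or end at the same point, and for every cycle and every two of its nodes the displacements accumulated along the two paths of the cycle between them are equal. Growth processes. A cycle-preserving growth process in the adjacency graph model starts from an initial shape $S_1^b=S_0$ and in each time step $t$ applies a collision-free set of growth operations to $S_t^b$ (deleting no edges), obtaining $S_t^e$, and then sets $S_{t+1}^b=AC(S_t^e)$. It grows $S$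 in $t_f$ steps if the shape after step $t_f$ is $S$. $\mathcal C_k$ is the class of shapes having a rooted spanning tree in which every root-to-leaf path has at most $k$ turns (nodes at which the path makes a right angle). *)

theory Defs
  imports Main Complex_Main
begin

text \<open>Grid points, shapes (nodes identified with the grid points they occupy;
  edges are two-element sets of points).\<close>

type_synonym pt = "int \<times> int"
type_synonym shape = "pt set \<times> pt set set"

definition padd :: "pt \<Rightarrow> pt \<Rightarrow> pt" where
  "padd p q = (fst p + fst q, snd p + snd q)"

definition psub :: "pt \<Rightarrow> pt \<Rightarrow> pt" where
  "psub p q = (fst p - fst q, snd p - snd q)"

definition grid_adj :: "pt \<Rightarrow> pt \<Rightarrow> bool" where
  "grid_adj p q \<longleftrightarrow> \<bar>fst p - fst q\<bar> + \<bar>snd p - snd q\<bar> = 1"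

definition edge_rel :: "pt set set \<Rightarrow> (pt \<times> pt) set" where
  "edge_rel E = {(p, q). {p, q} \<in> E}"

definition is_shape :: "shape \<Rightarrow> bool" where
  "is_shape S \<longleftrightarrow> finite (fst S) \<and> fst S \<noteq> {} \<and>
     snd S \<subseteq> {{p, q} | p q. p \<in> fst S \<and> q \<in> fst S \<and> grid_adj p q} \<and>
     (\<forall>p\<in>fst S. \<forall>q\<in>fst S. (p, q) \<in> (edge_rel (snd S))\<^sup>*)"

text \<open>Adjacency closure.\<close>
definition AC :: "shape \<Rightarrow> shape" where
  "AC S = (fst S, snd S \<union> {{p, q} | p q. p \<in> fst S \<and> q \<in> fst S \<and> grid_adj p q})"

text \<open>Equality up to translation.\<close>
definition shift :: "pt \<Rightarrow> shape \<Rightarrow> shape" where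
  "shift c S = ((\<lambda>p. padd p c) ` fst S, (\<lambda>e. (\<lambda>p. padd p c) ` e) ` snd S)"

definition congruent_shape :: "shape \<Rightarrow> shape \<Rightarrow> bool" where
  "congruent_shape S T \<longleftrightarrow> (\<exists>c. T = shift c S)"

definition single_node :: shape where
  "single_node = ({(0, 0)}, {})"

definition unit_dirs :: "pt set" where
  "unit_dirs = {(1, 0), (-1, 0), (0, 1), (0, -1)}"

text \<open>Linear motion from start point s by displacement d, at time t in [0,1].\<close>
definition mov :: "pt \<Rightarrow> pt \<Rightarrow> real \<Rightarrow> real \<times> real" where
  "mov s d t = (of_int (fst s) + t * of_int (fst d), of_int (snd s) + t * of_int (snd d))"

text \<open>One time step: a collision-free set of growth operations, all in direction \<delta>,
  applied to the nodes of A (each node at most one operation). Old node w is displaced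
  by D w; the new node created by the operation on u ends at u + D u + \<delta>.
  X is the set of edges {u, u+\<delta>} that are subdivided (operation type (ii)).
  The displacement D is the (cycle-consistent) accumulation of the unit translations
  of the type (ii) operations, with the anchor u0 stationary.\<close>
definition growth_step :: "shape \<Rightarrow> shape \<Rightarrow> bool" where
  "growth_step S S' \<longleftrightarrow> (\<exists>\<delta> A D u0.
     \<delta> \<in> unit_dirs \<and> A \<subseteq> fst S \<and> u0 \<in> fst S \<and> D u0 = (0, 0) \<and>
     (let V = fst S; E = snd S;
          X = {e \<in> E. \<exists>u\<in>A. e = {u, padd u \<delta>}};
          fin = (\<lambda>x. case x of Inl w \<Rightarrow> padd w (D w) | Inr u \<Rightarrow> padd (padd u (D u)) \<delta>);
          nodes = Inl ` V \<union> Inr ` A;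
          traj = (\<lambda>x t. case x of Inl w \<Rightarrow> mov w (D w) t
                                | Inr u \<Rightarrow> mov u (padd (D u) \<delta>) t);
          E0 = (\<lambda>e. Inl ` e) ` (E - X)
               \<union> {{Inl u, Inr u} | u. u \<in> A}
               \<union> {{Inr u, Inl (padd u \<delta>)} | u. u \<in> A \<and> {u, padd u \<delta>} \<in> E}
      in (\<forall>a b. {a, b} \<in> E \<longrightarrow>
             psub (D b) (D a) = (if {a, b} \<in> X then psub b a else (0, 0))) \<and>
         (\<forall>x\<in>nodes. \<forall>y\<in>nodes. x \<noteq> y \<longrightarrow>
             (\<forall>t::real. 0 < t \<and> t \<le> 1 \<longrightarrow> traj x t \<noteq> traj y t)) \<and>
         S' = (fin ` nodes, (\<lambda>e. fin ` e) ` E0)))"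

text \<open>Cycle-preserving growth process: B t is S^b_{t+1}; the shape after step tf is
  B tf = AC(S^e_{tf}) (or the initial shape if tf = 0).\<close>
definition grows_in :: "shape \<Rightarrow> shape \<Rightarrow> nat \<Rightarrow> bool" where
  "grows_in S0 T tf \<longleftrightarrow> (\<exists>B :: nat \<Rightarrow> shape. B 0 = S0 \<and>
     (\<forall>t<tf. \<exists>Se. growth_step (B t) Se \<and> B (Suc t) = AC Se) \<and>
     congruent_shape (B tf) T)"

text \<open>Class C_k.\<close>
definition spanning_tree :: "shape \<Rightarrow> pt set set \<Rightarrow> bool" where
  "spanning_tree S T \<longleftrightarrow> T \<subseteq> snd S \<and>
     (\<forall>p\<in>fst S. \<forall>q\<in>fst S. (p, q) \<in> (edge_rel T)\<^sup>*) \<and>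
     (\<forall>e\<in>T. \<forall>p q. e = {p, q} \<longrightarrow> (p, q) \<notin> (edge_rel (T - {e}))\<^sup>*)"

definition tree_path :: "pt set set \<Rightarrow> pt list \<Rightarrow> bool" where
  "tree_path T xs \<longleftrightarrow> xs \<noteq> [] \<and> distinct xs \<and>
     (\<forall>i. Suc i < length xs \<longrightarrow> {xs ! i, xs ! Suc i} \<in> T)"

definition turns :: "pt list \<Rightarrow> nat" where
  "turns xs = card {i. 0 < i \<and> Suc i < length xs \<and>
     (let a = psub (xs ! i) (xs ! (i - 1)); b = psub (xs ! Suc i) (xs ! i)
      in fst a * fst b + snd a * snd b = 0)}"

definition is_leaf :: "pt set set \<Rightarrow> pt \<Rightarrow> pt \<Rightarrow> bool" where
  "is_leaf T r v \<longleftrightarrow> v \<noteq> r \<and> card {e \<in> T. v \<in> e} = 1"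

definition in_Ck :: "nat \<Rightarrow> shape \<Rightarrow> bool" where
  "in_Ck k S \<longleftrightarrow> (\<exists>T r. spanning_tree S T \<and> r \<in> fst S \<and>
     (\<forall>xs. tree_path T xs \<and> hd xs = r \<and> is_leaf T r (last xs) \<longrightarrow> turns xs \<le> k))"

end

theory Submission
  imports Defs
begin

text \<open>
  Fully adjacency-closed shapes are determined by their vertex sets. A set \<open>U\<close> is extended
  inside the target along all straight segments in a fixed direction \<open>\<delta>\<close> in
  \<open>O(log n)\<close> steps, as follows. Lines parallel to \<open>\<delta>\<close> are
  treated by parity. On the lines of one parity, the missing cells that have a perpendicular
  neighbour in \<open>U\<close> are first created sideways, in two steps. The cells still missing form
  runs with no perpendicular neighbours at all, so they are not locked to anything by the adjacency
  closure, and all of them grow in parallel by doubling. Extending once in each of the four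
  directions reaches every node one turn further from the root, so \<open>k + 1\<close> such sweeps
  suffice.
\<close>

subsection \<open>Steps on vertex sets\<close>

declare split_paired_Ex [simp del] split_paired_All [simp del]

text \<open>The obstacle is the adjacency closure. In a step along \<delta>, an edge between two
  neighbouring lines forces its ends to be displaced equally, whereas doubling needs displacements
  that grow along a run; touching runs could not double independently of each other. During a
  doubling phase the nodes present at its start never move: only run cells do, and each run is
  confined to free cells ahead of the node it stands on. So every intermediate set lies inside the
  target and no room has to be made.

  All straight segments of cells of S are filled, not just those of the spanning tree. This makes
  extension monotone and idempotent, and the additional cells belong to S anyway; the tree serves
  only to count turns.

  With \<open>card S < 2 ^ s\<close>, one parity of one direction takes two sideways steps and
  \<open>s\<close> doublings. Two parities and four directions give \<open>8 * (2 + s)\<close> steps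
  per sweep.\<close>

definition full :: "pt set \<Rightarrow> shape" where
  "full V = (V, {{p, q} | p q. p \<in> V \<and> q \<in> V \<and> grid_adj p q})"

definition along :: "pt \<Rightarrow> pt \<Rightarrow> int \<Rightarrow> pt" where
  "along \<delta> p i = (fst p + i * fst \<delta>, snd p + i * snd \<delta>)"

text \<open>The two-dimensional cross product with \<delta>; for a unit direction it is an integer
  coordinate numbering the lines parallel to \<delta>.\<close>

definition cross :: "pt \<Rightarrow> pt \<Rightarrow> int" where
  "cross \<delta> p = fst \<delta> * snd p - snd \<delta> * fst p"

lemma fst_full [simp]: "fst (full V) = V"
  by (simp add: full_def)

lemma along_along [simp]: "along \<delta> (along \<delta> p i) j = along \<delta> p (i + j)"
  by (simp add: along_def algebra_simps)

lemma along_0 [simp]: "along \<delta> p 0 = p"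
  by (simp add: along_def)

lemma along_inj: "\<delta> \<in> unit_dirs \<Longrightarrow> along \<delta> p i = along \<delta> p j \<longleftrightarrow> i = j"
  by (auto simp: along_def unit_dirs_def)

lemma cross_along [simp]: "cross \<delta> (along \<delta> p i) = cross \<delta> p"
  by (simp add: cross_def along_def algebra_simps)

lemma padd_eq_along: "padd p \<delta> = along \<delta> p 1"
  by (simp add: padd_def along_def)

lemma cross_eq_along:
  assumes "\<delta> \<in> unit_dirs" "cross \<delta> a = cross \<delta> b"
  obtains j where "b = along \<delta> a j"
proof
  \<comment> \<open>The witness is the scalar product of \<open>b - a\<close> with the unit vector
    \<delta>.\<close>
  show "b = along \<delta> a ((fst b - fst a) * fst \<delta> + (snd b - snd a) * snd \<delta>)"
    using assms by (cases a; cases b) (auto simp: unit_dirs_def cross_def along_def)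
qed

lemma grid_adj_cases:
  assumes "\<delta> \<in> unit_dirs" "grid_adj a b"
  obtains "b = along \<delta> a 1" | "a = along \<delta> b 1" | "cross \<delta> a \<noteq> cross \<delta> b"
proof -
  have "b = along \<delta> a 1 \<or> a = along \<delta> b 1 \<or> cross \<delta> a \<noteq> cross \<delta> b"
    using assms by (cases a; cases b) (auto simp: unit_dirs_def cross_def along_def grid_adj_def)
  then show thesis using that by blast
qed

lemma grid_adj_along: "\<delta> \<in> unit_dirs \<Longrightarrow> grid_adj p (along \<delta> p 1)"
  by (auto simp: unit_dirs_def along_def grid_adj_def)

lemma grid_adj_sym: "grid_adj a b \<Longrightarrow> grid_adj b a"
  by (simp add: grid_adj_def)

lemma grid_adj_along_both: "grid_adj a b \<Longrightarrow> grid_adj (along \<delta> a i) (along \<delta> b i)"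
  by (simp add: along_def grid_adj_def)

text \<open>A growth step in direction \<open>\<delta>\<close> whose displacements are
  \<open>d w\<close> times \<open>\<delta>\<close>. Requiring that final positions on a line keep their
  order already excludes collisions during the motion.\<close>
definition set_step :: "pt set \<Rightarrow> pt set \<Rightarrow> bool" where
  "set_step V V' \<longleftrightarrow> (\<exists>\<delta> A d. \<delta> \<in> unit_dirs \<and> A \<subseteq> V \<and> (\<exists>u\<in>V. d u = 0) \<and>
     (\<forall>a\<in>V. along \<delta> a 1 \<in> V \<longrightarrow> d (along \<delta> a 1) = d a + of_bool (a \<in> A)) \<and>
     (\<forall>a\<in>V. \<forall>b\<in>V. grid_adj a b \<longrightarrow> cross \<delta> a \<noteq> cross \<delta> b \<longrightarrow> d a = d b) \<and>
     (\<forall>a\<in>V. \<forall>j\<ge>1. along \<delta> a j \<in> V \<longrightarrow> d a + of_bool (a \<in> A) < j + d (along \<delta> a j)) \<and>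
     V' = (\<lambda>a. along \<delta> a (d a)) ` V \<union> (\<lambda>a. along \<delta> a (d a + 1)) ` A)"

text \<open>A meeting at time \<open>t\<close> forces both nodes onto one line and gives
  \<open>t * (e - f) = j\<close>, where \<open>j\<close> is the initial offset of \<open>b\<close>
  from \<open>a\<close>. For \<open>j \<ge> 1\<close> the order of the final positions gives
  \<open>e - f < j\<close>, and \<open>t \<le> 1\<close> keeps the left side below \<open>j\<close>;
  negative \<open>j\<close> is symmetric, and \<open>j = 0\<close> with \<open>t > 0\<close> forces
  \<open>e = f\<close>. Letting \<open>e\<close> be \<open>d a\<close> or \<open>d a + 1\<close>
  covers an old node and the node it creates together.\<close>

lemma ordered_motion_collision_free:
  fixes d :: "pt \<Rightarrow> int" and e f :: int and t :: real
  assumes dir: "\<delta> \<in> unit_dirs"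
    and ord: "\<forall>a\<in>V. \<forall>j\<ge>1. along \<delta> a j \<in> V \<longrightarrow> d a + of_bool (a \<in> A) < j + d (along \<delta> a j)"
    and "a \<in> V" "b \<in> V" and t: "0 < t" "t \<le> 1"
    and e: "d a \<le> e" "e \<le> d a + of_bool (a \<in> A)"
    and f: "d b \<le> f" "f \<le> d b + of_bool (b \<in> A)"
    and ne: "a \<noteq> b \<or> e \<noteq> f"
  shows "mov a (along \<delta> (0, 0) e) t \<noteq> mov b (along \<delta> (0, 0) f) t"
proof
  assume eq: "mov a (along \<delta> (0, 0) e) t = mov b (along \<delta> (0, 0) f) t"
  then have 1: "of_int (fst a) + t * of_int (e * fst \<delta>) = of_int (fst b) + t * of_int (f * fst \<delta>)"
    and 2: "of_int (snd a) + t * of_int (e * snd \<delta>) = of_int (snd b) + t * of_int (f * snd \<delta>)"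
    by (simp_all add: mov_def along_def)
  have "cross \<delta> a = cross \<delta> b"
    using dir 1 2 by (auto simp: unit_dirs_def cross_def)
  then obtain j where j: "b = along \<delta> a j"
    using dir cross_eq_along by metis
  have tj: "t * of_int (e - f) = of_int j"
    using dir 1 2 by (auto simp: unit_dirs_def j along_def algebra_simps)
  have small: "t * of_int m < of_int n" if "m < n" "0 < n" for m n :: int
  proof (cases "m \<le> 0")
    case True
    then have "t * of_int m \<le> 0" using t by (simp add: mult_nonneg_nonpos)
    with that show ?thesis by (simp add: le_less_trans)
  next
    case False
    then have "t * of_int m \<le> 1 * of_int m" using t by (intro mult_right_mono) auto
    with that show ?thesis by (simp add: le_less_trans)
  qed
  consider "j = 0" | "j \<ge> 1" | "j \<le> -1" by linarith
  then show False
  proof cases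
    case 1
    then show False using tj t ne j by auto
  next
    case 2
    then have "e - f < j" using ord \<open>a \<in> V\<close> \<open>b \<in> V\<close> e f j by force
    with small[of "e - f" j] 2 tj show False by simp
  next
    case 3
    have "a = along \<delta> b (-j)" by (simp add: j)
    then have "d b + of_bool (b \<in> A) < - j + d a"
      using ord[rule_format, of b "- j"] \<open>a \<in> V\<close> \<open>b \<in> V\<close> 3 by simp
    then have "f - e < -j" using e f by linarith
    with small[of "f - e" "-j"] 3 tj show False by (simp add: algebra_simps)
  qed
qed

text \<open>The closure forgets which edges a step produces, as long as each joins adjacent points.
  So besides the motion conditions it remains to compute the final vertex set and to see that no
  edge is stretched.\<close>

lemma set_step_growth_step:
  assumes "set_step V V'"
  obtains Se where "growth_step (full V) Se" "AC Se = full V'"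
proof -
  obtain \<delta> A d where dir: "\<delta> \<in> unit_dirs" and A: "A \<subseteq> V" and anchor: "\<exists>u\<in>V. d u = 0"
    and par0: "\<forall>a\<in>V. along \<delta> a 1 \<in> V \<longrightarrow> d (along \<delta> a 1) = d a + of_bool (a \<in> A)"
    and perp0: "\<forall>a\<in>V. \<forall>b\<in>V. grid_adj a b \<longrightarrow> cross \<delta> a \<noteq> cross \<delta> b \<longrightarrow> d a = d b"
    and ord: "\<forall>a\<in>V. \<forall>j\<ge>1. along \<delta> a j \<in> V \<longrightarrow> d a + of_bool (a \<in> A) < j + d (along \<delta> a j)"
    and V': "V' = (\<lambda>a. along \<delta> a (d a)) ` V \<union> (\<lambda>a. along \<delta> a (d a + 1)) ` A"
    using assms unfolding set_step_def by (elim exE conjE) (rule that; assumption)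
  note par = par0[rule_format] and perp = perp0[rule_format]
  define E where "E = snd (full V)"
  define D where "D = (\<lambda>w. along \<delta> (0, 0) (d w))"
  define X where "X = {e \<in> E. \<exists>u\<in>A. e = {u, padd u \<delta>}}"
  define fin :: "pt + pt \<Rightarrow> pt" where
    "fin = (\<lambda>x. case x of Inl w \<Rightarrow> padd w (D w) | Inr u \<Rightarrow> padd (padd u (D u)) \<delta>)"
  define nodes where "nodes = Inl ` V \<union> Inr ` A"
  define traj :: "pt + pt \<Rightarrow> real \<Rightarrow> real \<times> real" where
    "traj = (\<lambda>x t. case x of Inl w \<Rightarrow> mov w (D w) t | Inr u \<Rightarrow> mov u (padd (D u) \<delta>) t)"
  define E0 where "E0 = (\<lambda>e. Inl ` e) ` (E - X)
               \<union> {{Inl u, Inr u} | u. u \<in> A}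
               \<union> {{Inr u, Inl (padd u \<delta>)} | u. u \<in> A \<and> {u, padd u \<delta>} \<in> E}"
  define Se where "Se = (fin ` nodes, (\<lambda>e. fin ` e) ` E0)"
  have inE: "{a, b} \<in> E \<longleftrightarrow> a \<in> V \<and> b \<in> V \<and> grid_adj a b" for a b
    unfolding E_def full_def snd_conv mem_Collect_eq doubleton_eq_iff by (metis grid_adj_sym)
  have fin_Inl: "fin (Inl w) = along \<delta> w (d w)" and fin_Inr: "fin (Inr w) = along \<delta> w (d w + 1)" for w
    by (simp_all add: fin_def D_def padd_def along_def algebra_simps)
  have traj_Inl: "traj (Inl w) = mov w (along \<delta> (0,0) (d w))"
    and traj_Inr: "traj (Inr w) = mov w (along \<delta> (0,0) (d w + 1))" for w
    by (simp_all add: traj_def D_def padd_def along_def algebra_simps fun_eq_iff)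
  \<comment> \<open>The edge \<open>{a, along \<delta> a 1}\<close> has the form
    \<open>{u, padd u \<delta>}\<close> only for \<open>u = a\<close>: the other matching would
    return to the start after two steps along \<delta>.\<close>
  have not_back: "along \<delta> a 2 \<noteq> a" for a
    using along_inj[OF dir, of a 2 0] by simp
  have X_par: "{a, along \<delta> a 1} \<in> X \<longleftrightarrow> a \<in> A" if "{a, along \<delta> a 1} \<in> E" for a
    using that not_back by (auto simp: X_def padd_eq_along doubleton_eq_iff)
  have X_perp: "{a, b} \<notin> X" if "cross \<delta> a \<noteq> cross \<delta> b" for a b
    using that by (auto simp: X_def padd_eq_along doubleton_eq_iff)
  have disp: "psub (D b) (D a) = (if {a, b} \<in> X then psub b a else (0, 0))" if ab: "{a, b} \<in> E" for a b
  proof -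
    have abV: "a \<in> V" "b \<in> V" "grid_adj a b" using ab inE by auto
    from dir abV(3) show ?thesis
    proof (cases rule: grid_adj_cases)
      case 1
      then have "d b = d a + of_bool (a \<in> A)" "{a, b} \<in> X \<longleftrightarrow> a \<in> A"
        using par abV X_par ab by auto
      then show ?thesis using 1 by (auto simp: D_def psub_def along_def algebra_simps)
    next
      case 2
      then have "d a = d b + of_bool (b \<in> A)" "{a, b} \<in> X \<longleftrightarrow> b \<in> A"
        using par abV X_par[of b] ab by (auto simp: insert_commute)
      then show ?thesis using 2 by (auto simp: D_def psub_def along_def algebra_simps)
    next
      case 3
      then show ?thesis using perp[OF abV 3] X_perp by (auto simp: D_def psub_def)
    qed
  qed
  have coll: "\<forall>x\<in>nodes. \<forall>y\<in>nodes. x \<noteq> y \<longrightarrow> (\<forall>t::real. 0 < t \<and> t \<le> 1 \<longrightarrow> traj x t \<noteq> traj y t)"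
  proof (intro ballI impI allI)
    fix x y :: "pt + pt" and t :: real
    assume *: "x \<in> nodes" "y \<in> nodes" "x \<noteq> y" "0 < t \<and> t \<le> 1"
    \<comment> \<open>Origin and total displacement; a created node is regarded as leaving the node
      that creates it, with one unit more.\<close>
    define data :: "pt + pt \<Rightarrow> pt \<times> int" where
      "data = (\<lambda>z. case z of Inl w \<Rightarrow> (w, d w) | Inr w \<Rightarrow> (w, d w + 1))"
    have data: "fst (data z) \<in> V" "d (fst (data z)) \<le> snd (data z)"
       "snd (data z) \<le> d (fst (data z)) + of_bool (fst (data z) \<in> A)"
       "traj z = mov (fst (data z)) (along \<delta> (0, 0) (snd (data z)))" if "z \<in> nodes" for z
      using that A by (auto simp: nodes_def data_def traj_Inl traj_Inr)
    have "fst (data x) \<noteq> fst (data y) \<or> snd (data x) \<noteq> snd (data y)"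
      using * by (auto simp: data_def nodes_def)
    then show "traj x t \<noteq> traj y t"
      using ordered_motion_collision_free[OF dir ord] data[OF *(1)] data[OF *(2)] *(4) by simp
  qed
  obtain u0 where u0: "u0 \<in> V" "D u0 = (0, 0)"
    using anchor by (auto simp: D_def)
  have "growth_step (full V) Se"
    unfolding growth_step_def Let_def fst_full
    apply (rule exI[of _ \<delta>], rule exI[of _ A], rule exI[of _ D], rule exI[of _ u0])
    apply (fold E_def)
    apply (fold X_def fin_def nodes_def)
    apply (fold E0_def)
    using dir A u0 disp coll[unfolded traj_def] by (simp add: Se_def)
  moreover have "AC Se = full V'"
  proof -
    have fV: "fin ` nodes = V'"
      by (auto simp: V' nodes_def image_Un image_image fin_Inl fin_Inr)
    have edge: "\<exists>p q. fin ` e = {p, q} \<and> p \<in> V' \<and> q \<in> V' \<and> grid_adj p q"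
      if "e = {x, y}" "x \<in> nodes" "y \<in> nodes" "grid_adj (fin x) (fin y)" for e x y
      using that fV by (metis image_empty image_eqI image_insert)
    have "\<exists>p q. fin ` e = {p, q} \<and> p \<in> V' \<and> q \<in> V' \<and> grid_adj p q" if e: "e \<in> E0" for e
    proof -
      consider (old) a b where "e = {Inl a, Inl b}" "{a, b} \<in> E" "{a, b} \<notin> X"
        | (new) u where "e = {Inl u, Inr u}" "u \<in> A"
        | (far) u where "e = {Inr u, Inl (padd u \<delta>)}" "u \<in> A" "{u, padd u \<delta>} \<in> E"
      proof -
        from e consider f where "e = Inl ` f" "f \<in> E - X" | u where "e = {Inl u, Inr u}" "u \<in> A"
          | u where "e = {Inr u, Inl (padd u \<delta>)}" "u \<in> A" "{u, padd u \<delta>} \<in> E"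
          unfolding E0_def by blast
        then show thesis
        proof cases
          case 1
          then obtain a b where "f = {a, b}" by (auto simp: E_def full_def)
          then show thesis using 1 old by auto
        qed (use new far in blast)+
      qed
      then show ?thesis
      proof cases
        case old
        then have "D a = D b" using disp[of a b] by (auto simp: psub_def prod_eq_iff)
        then have "d a = d b" using along_inj[OF dir] by (simp add: D_def)
        then show ?thesis using old inE grid_adj_along_both[of a b \<delta> "d b"]
          by (intro edge[of e "Inl a" "Inl b"]) (auto simp: fin_Inl nodes_def)
      next
        case new
        then show ?thesis using A grid_adj_along[OF dir, of "along \<delta> u (d u)"]
          by (intro edge[of e "Inl u" "Inr u"]) (auto simp: fin_Inl fin_Inr nodes_def)
      next
        case far
        then have V: "u \<in> V" "along \<delta> u 1 \<in> V" using inE by (auto simp: padd_eq_along)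
        \<comment> \<open>A subdivided edge opens a gap of exactly one cell, which the new node
          occupies.\<close>
        then have "d (along \<delta> u 1) = d u + 1" using par far by simp
        then have "fin (Inl (padd u \<delta>)) = along \<delta> (fin (Inr u)) 1"
          by (simp add: fin_Inl fin_Inr padd_eq_along)
        then show ?thesis using far V grid_adj_along[OF dir, of "fin (Inr u)"]
          by (intro edge[of e "Inr u" "Inl (padd u \<delta>)"]) (auto simp: nodes_def padd_eq_along)
      qed
    qed
    then have "(\<lambda>e. fin ` e) ` E0 \<subseteq> {{p, q} | p q. p \<in> V' \<and> q \<in> V' \<and> grid_adj p q}" by blast
    then show ?thesis by (auto simp: AC_def full_def Se_def fV)
  qed
  ultimately show thesis using that by blast
qed

subsection \<open>Doubling free runs\<close>

text \<open>Operations toward empty points push nothing, so all displacements are zero. Restricting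
  to \<open>Q - V\<close> selects exactly the operations of this kind.\<close>

lemma set_step_attach:
  assumes dir: "\<delta> \<in> unit_dirs" and "V \<noteq> {}" and Q: "\<And>q. q \<in> Q \<Longrightarrow> along \<delta> q (- 1) \<in> V"
  shows "set_step V (V \<union> Q)"
proof -
  define A where "A = (\<lambda>q. along \<delta> q (- 1)) ` (Q - V)"
  have A: "a \<in> V" "along \<delta> a 1 \<notin> V" if "a \<in> A" for a
    using that Q by (auto simp: A_def)
  have far: "of_bool (a \<in> A) < j" if "j \<ge> 1" "along \<delta> a j \<in> V" for a and j :: int
    using that A(2)[of a] by (cases "j = 1") auto
  have img: "(\<lambda>a. along \<delta> a 1) ` A = Q - V"
    by (simp add: A_def image_image)
  show ?thesis
    unfolding set_step_def
  proof (intro exI conjI)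
    show "V \<union> Q = (\<lambda>a. along \<delta> a ((\<lambda>_. 0) a)) ` V \<union> (\<lambda>a. along \<delta> a ((\<lambda>_. 0) a + 1)) ` A"
      using img by auto
  qed (use dir \<open>V \<noteq> {}\<close> A far in auto)
qed

text \<open>\<open>g p\<close> is the length of the run standing on \<open>p\<close>; it is \<open>0\<close> if there is none.\<close>
definition runs :: "pt \<Rightarrow> pt set \<Rightarrow> (pt \<Rightarrow> nat) \<Rightarrow> pt set" where
  "runs \<delta> V g = {along \<delta> p (int i) | p i. p \<in> V \<and> 1 \<le> i \<and> i \<le> g p}"

text \<open>The first conjunct also separates the runs: a run cell determines its base as the
  nearest node of \<open>V\<close> behind it. The second makes them movable: no edge added by the
  closure ties a run cell to another line.\<close>

definition free_runs :: "pt \<Rightarrow> pt set \<Rightarrow> (pt \<Rightarrow> nat) \<Rightarrow> bool" where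
  "free_runs \<delta> V g \<longleftrightarrow> runs \<delta> V g \<inter> V = {} \<and>
     (\<forall>a\<in>runs \<delta> V g. \<forall>b\<in>V \<union> runs \<delta> V g. grid_adj a b \<longrightarrow> cross \<delta> a = cross \<delta> b)"

lemma runs_mono: "(\<And>p. f p \<le> g p) \<Longrightarrow> runs \<delta> V f \<subseteq> runs \<delta> V g"
  unfolding runs_def using order_trans by blast

lemma Un_runs_eq: "V \<union> runs \<delta> V f = {along \<delta> p (int i) | p i. p \<in> V \<and> i \<le> f p}" (is "_ = ?R")
proof
  have "q \<in> ?R" if "q \<in> V" for q
    using that by (intro CollectI exI[of _ q] exI[of _ "0::nat"]) simp
  then show "V \<union> runs \<delta> V f \<subseteq> ?R" unfolding runs_def by blast
  show "?R \<subseteq> V \<union> runs \<delta> V f"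
  proof
    fix q assume "q \<in> ?R"
    then obtain p i where "q = along \<delta> p (int i)" "p \<in> V" "i \<le> f p" by blast
    then show "q \<in> V \<union> runs \<delta> V f" unfolding runs_def by (cases "i = 0") (auto simp: Suc_le_eq)
  qed
qed

text \<open>Count the base as position 0 of its run and let \<open>n = g p - N\<close>. Positions
  \<open>i < n\<close> are duplicated and end at \<open>2 * i\<close> and \<open>2 * i + 1\<close>;
  the remaining ones are pushed by \<open>n\<close>. If all of \<open>0..N\<close> are duplicated,
  the run reaches \<open>2 * N + 1\<close>; otherwise it ends exactly at \<open>g p\<close>. Since
  the base duplicates as well, growth can start from \<open>N = 0\<close>.\<close>

lemma runs_doubling_step:
  assumes dir: "\<delta> \<in> unit_dirs" and "V \<noteq> {}" and free: "free_runs \<delta> V g"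
  shows "set_step (V \<union> runs \<delta> V (\<lambda>p. min (g p) N)) (V \<union> runs \<delta> V (\<lambda>p. min (g p) (2 * N + 1)))"
proof -
  define C where "C = V \<union> runs \<delta> V (\<lambda>p. min (g p) N)"
  \<comment> \<open>Distance back to the nearest node of \<open>V\<close>. On a run this is the
    index of the cell, because no node of \<open>V\<close> lies strictly in between.\<close>
  define pos where "pos q = (LEAST i::nat. along \<delta> q (- int i) \<in> V)" for q
  define base where "base q = along \<delta> q (- int (pos q))" for q
  \<comment> \<open>Truncated subtraction makes completed runs (of length at most \<open>N\<close>) stay at rest.\<close>
  define d where "d q = min (pos q) (g (base q) - N)" for q
  define A where "A = {q \<in> C. pos q < g (base q) - N}"
  have gap: "along \<delta> p (int i) \<notin> V" if "p \<in> V" "1 \<le> i" "i \<le> g p" for p i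
    using free that unfolding free_runs_def runs_def by blast
  have pos_run: "pos (along \<delta> p (int i)) = i" if "p \<in> V" "i \<le> g p" for p i
    unfolding pos_def
  proof (rule Least_equality)
    show "along \<delta> (along \<delta> p (int i)) (- int i) \<in> V" using that by simp
    show "i \<le> j" if j: "along \<delta> (along \<delta> p (int i)) (- int j) \<in> V" for j
    proof (rule ccontr)
      assume "\<not> i \<le> j"
      then have "along \<delta> (along \<delta> p (int i)) (- int j) = along \<delta> p (int (i - j))" by (simp add: of_nat_diff)
      then show False using gap[OF \<open>p \<in> V\<close>, of "i - j"] j \<open>\<not> i \<le> j\<close> \<open>i \<le> g p\<close> by simp
    qed
  qed
  have base_run: "base (along \<delta> p (int i)) = p" if "p \<in> V" "i \<le> g p" for p i
    using that by (simp add: base_def pos_run)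
  have C_elim: "\<exists>p i. q = along \<delta> p (int i) \<and> p \<in> V \<and> i \<le> g p \<and> i \<le> N" if "q \<in> C" for q
    using that unfolding C_def Un_runs_eq by auto
  have C_intro: "along \<delta> p (int i) \<in> C" if "p \<in> V" "i \<le> g p" "i \<le> N" for p i
    using that unfolding C_def Un_runs_eq by auto
  have dV: "d q = 0" "base q = q" "pos q = 0" if "q \<in> V" for q
    using pos_run[of q 0] base_run[of q 0] that by (simp_all add: d_def)
  have beyond: "int (g p) < j" if "p \<in> V" "along \<delta> p j \<in> V" "0 < j" for p j
  proof (rule ccontr)
    assume "\<not> int (g p) < j"
    then have "1 \<le> nat j" "nat j \<le> g p" "int (nat j) = j" using that by linarith+
    then show False using gap[OF \<open>p \<in> V\<close>, of "nat j"] that by metis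
  qed
  have par: "d (along \<delta> a 1) = d a + of_bool (a \<in> A)" if a: "a \<in> C" and a1: "along \<delta> a 1 \<in> C" for a
  proof -
    from C_elim[OF a] obtain p i where p: "a = along \<delta> p (int i)" "p \<in> V" "i \<le> g p" "i \<le> N" by blast
    have da: "d a = min i (g p - N)" and Aa: "a \<in> A \<longleftrightarrow> i < g p - N"
      using p a by (simp_all add: d_def A_def pos_run base_run)
    have a1': "along \<delta> a 1 = along \<delta> p (int (Suc i))" using p by (simp add: add.commute)
    show ?thesis
    proof (cases "Suc i \<le> g p")
      case True
      then have "d (along \<delta> a 1) = min (Suc i) (g p - N)"
        unfolding a1' using p by (simp add: d_def pos_run base_run del: of_nat_Suc)
      then show ?thesis using da Aa by auto
    next
      \<comment> \<open>The run is complete, so its end stays at rest. The occupied cell just ahead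
        must then be a node of \<open>V\<close>: as a run cell it would make a run pass over a node
        of \<open>V\<close> or exceed its own length.\<close>
      case False
      then have "g p - N = 0" "i = g p" using p by auto
      moreover have "d (along \<delta> a 1) = 0"
      proof -
        from C_elim[OF a1] obtain p' i' where p': "along \<delta> a 1 = along \<delta> p' (int i')" "p' \<in> V" "i' \<le> g p'" "i' \<le> N"
          by blast
        then have eq: "p' = along \<delta> p (int (Suc i) - int i')"
          unfolding a1' by (metis (no_types, opaque_lifting) along_0 along_along add.right_inverse diff_conv_add_uminus)
        show ?thesis
        proof (cases "i' = 0")
          case True
          then show ?thesis using dV p' by simp
        next
          case False
          have "i' \<le> i \<Longrightarrow> False"
            using gap[OF \<open>p \<in> V\<close>, of "Suc i - i'"] p'(2) False \<open>i = g p\<close> unfolding eq by (simp add: of_nat_diff)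
          moreover have "i' = Suc i \<Longrightarrow> False"
            using eq p' \<open>i = g p\<close> \<open>\<not> Suc i \<le> g p\<close> by simp
          moreover have "i' > Suc i \<Longrightarrow> False"
          proof -
            assume "i' > Suc i"
            then have "along \<delta> p' (int (i' - Suc i)) \<in> V"
              using p(2) unfolding eq by (simp add: of_nat_diff)
            moreover have "1 \<le> i' - Suc i" "i' - Suc i \<le> g p'" using p'(3) \<open>i' > Suc i\<close> by linarith+
            ultimately show False using gap[OF p'(2)] by blast
          qed
          ultimately show ?thesis using less_linear[of i' "Suc i"] by (auto simp: less_Suc_eq_le)
        qed
      qed
      ultimately show ?thesis using da Aa by simp
    qed
  qed
  have perp: "d a = d b" if ab: "a \<in> C" "b \<in> C" "grid_adj a b" "cross \<delta> a \<noteq> cross \<delta> b" for a b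
  proof -
    have "runs \<delta> V (\<lambda>p. min (g p) N) \<subseteq> runs \<delta> V g" by (rule runs_mono) simp
    then have sub: "C \<subseteq> V \<union> runs \<delta> V g" by (auto simp: C_def)
    \<comment> \<open>By freeness a node with a neighbour on another line is no run cell; only nodes
      of \<open>V\<close>, all at rest, touch across lines.\<close>
    have stray: "x \<in> V" if "x \<in> C" "y \<in> C" "grid_adj x y" "cross \<delta> x \<noteq> cross \<delta> y" for x y
    proof (rule ccontr)
      assume "x \<notin> V"
      then have "x \<in> runs \<delta> V g" "y \<in> V \<union> runs \<delta> V g" using that sub by auto
      then show False using free that unfolding free_runs_def by blast
    qed
    have "a \<in> V" "b \<in> V"
      using stray[of a b] stray[of b a] ab grid_adj_sym[OF ab(3)] by simp_all
    then show ?thesis by (simp add: dV)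
  qed
  have ord: "int (d a) + of_bool (a \<in> A) < j + int (d (along \<delta> a j))"
    if a: "a \<in> C" and j: "1 \<le> j" and aj: "along \<delta> a j \<in> C" for a j
  proof -
    from C_elim[OF a] obtain p i where p: "a = along \<delta> p (int i)" "p \<in> V" "i \<le> g p" "i \<le> N" by blast
    have da: "d a = min i (g p - N)" and Aa: "a \<in> A \<longleftrightarrow> i < g p - N"
      using p a by (simp_all add: d_def A_def pos_run base_run)
    from C_elim[OF aj] obtain p' i' where p': "along \<delta> a j = along \<delta> p' (int i')" "p' \<in> V" "i' \<le> g p'" "i' \<le> N"
      by blast
    then have eq: "p' = along \<delta> p (int i + j - int i')"
      unfolding p(1) by (metis (no_types, opaque_lifting) along_0 along_along add.right_inverse diff_conv_add_uminus)
    have dj: "d (along \<delta> a j) = min i' (g p' - N)"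
      using p' by (simp add: d_def pos_run base_run)
    \<comment> \<open>The three cases say where \<open>p'\<close> lies relative to \<open>p\<close>:
      equal, behind, or ahead. Behind is impossible, since the run of \<open>p'\<close> would pass
      over \<open>p\<close>. Ahead, \<open>p'\<close> lies beyond the full length
      \<open>g p\<close>, which the image of \<open>a\<close> and the node created by
      \<open>a\<close> never exceed.\<close>
    consider "int i + j = int i'" | "int i + j < int i'" | "int i + j > int i'" by linarith
    then show ?thesis
    proof cases
      case 1
      then have "p' = p" using eq by simp
      then show ?thesis using 1 da Aa dj j by auto
    next
      case 2
      have "along \<delta> p' (int i' - (int i + j)) = p" using eq by simp
      with beyond[OF p'(2), of "int i' - (int i + j)"] p(2) 2 p'(3) j show ?thesis by simp
    next
      case 3
      have "int (g p) < int i + j - int i'"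
        using beyond[OF p(2), of "int i + j - int i'"] p'(2) eq 3 by simp
      then show ?thesis using da Aa p j by (auto simp: min_def split: if_splits)
    qed
  qed
  have img: "V \<union> runs \<delta> V (\<lambda>p. min (g p) (2 * N + 1)) =
      (\<lambda>a. along \<delta> a (int (d a))) ` C \<union> (\<lambda>a. along \<delta> a (int (d a) + 1)) ` A" (is "?L = ?R")
  proof
    show "?R \<subseteq> ?L"
    proof
      fix q assume "q \<in> ?R"
      then obtain a where a: "a \<in> C" "q = along \<delta> a (int (d a)) \<or> a \<in> A \<and> q = along \<delta> a (int (d a) + 1)"
        unfolding A_def by blast
      from C_elim[OF a(1)] obtain p i where p: "a = along \<delta> p (int i)" "p \<in> V" "i \<le> g p" "i \<le> N" by blast
      have da: "d a = min i (g p - N)" and Aa: "a \<in> A \<longleftrightarrow> i < g p - N"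
        using p a by (simp_all add: d_def A_def pos_run base_run)
      have "\<exists>m. q = along \<delta> p (int m) \<and> m \<le> min (g p) (2 * N + 1)"
      proof (cases "q = along \<delta> a (int (d a))")
        case True
        then show ?thesis using p da by (intro exI[of _ "i + d a"]) auto
      next
        case False
        then show ?thesis using a(2) p da Aa by (intro exI[of _ "i + d a + 1"]) (auto simp: algebra_simps)
      qed
      then obtain m where m: "q = along \<delta> p (int m)" "m \<le> min (g p) (2 * N + 1)" by blast
      then show "q \<in> ?L" using p(2) unfolding Un_runs_eq by auto
    qed
    show "?L \<subseteq> ?R"
    proof
      fix q assume "q \<in> ?L"
      then have "\<exists>p m. q = along \<delta> p (int m) \<and> p \<in> V \<and> m \<le> g p \<and> m \<le> 2 * N + 1"
        unfolding Un_runs_eq by auto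
      then obtain p m where q: "q = along \<delta> p (int m)" "p \<in> V" "m \<le> g p" "m \<le> 2 * N + 1" by blast
      define n where "n = g p - N"
      have d_run: "d (along \<delta> p (int i)) = min i n" and A_run: "along \<delta> p (int i) \<in> A \<longleftrightarrow> i < n"
        if "i \<le> g p" "i \<le> N" for i
        using that q C_intro by (simp_all add: d_def A_def pos_run base_run n_def)
      show "q \<in> ?R"
      \<comment> \<open>The first \<open>2 * n\<close> positions arise by duplication, hence the
        preimage \<open>m div 2\<close>; later ones were pushed by \<open>n\<close>, hence
        \<open>m - n\<close>.\<close>
      proof (cases "m < 2 * n")
        case True
        define i where "i = m div 2"
        have i: "i \<le> g p" "i \<le> N" "i < n" using True q by (auto simp: i_def)
        let ?a = "along \<delta> p (int i)"
        have "?a \<in> A" "?a \<in> C" "d ?a = i" using i d_run A_run C_intro q by auto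
        moreover have "m = i + i \<or> m = i + i + 1" unfolding i_def by linarith
        then have "q = along \<delta> ?a (int i) \<or> q = along \<delta> ?a (int i + 1)" using q by (auto simp: algebra_simps)
        ultimately show ?thesis by (metis (no_types, lifting) UnI1 UnI2 image_eqI)
      next
        case False
        define i where "i = m - n"
        have i: "i \<le> g p" "i \<le> N" "n \<le> i" "m = i + n" using False q by (auto simp: i_def n_def)
        let ?a = "along \<delta> p (int i)"
        have "?a \<in> C" "d ?a = n" using i d_run C_intro q by auto
        moreover have "q = along \<delta> ?a (int n)" using q i by simp
        ultimately show ?thesis by (metis (no_types, lifting) UnI1 image_eqI)
      qed
    qed
  qed
  obtain v where v: "v \<in> V" using \<open>V \<noteq> {}\<close> by blast
  have par_int: "int (d (along \<delta> a 1)) = int (d a) + of_bool (a \<in> A)"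
    if "a \<in> C" "along \<delta> a 1 \<in> C" for a
    using par[OF that] by simp
  have "set_step C (V \<union> runs \<delta> V (\<lambda>p. min (g p) (2 * N + 1)))"
    unfolding set_step_def
  proof (rule exI[of _ \<delta>], rule exI[of _ A], rule exI[of _ "\<lambda>q. int (d q)"], intro conjI)
    show "\<exists>u\<in>C. int (d u) = 0" using v dV by (intro bexI[of _ v]) (auto simp: C_def)
    show "A \<subseteq> C" by (auto simp: A_def)
    show "\<forall>a\<in>C. \<forall>b\<in>C. grid_adj a b \<longrightarrow> cross \<delta> a \<noteq> cross \<delta> b \<longrightarrow> int (d a) = int (d b)"
      using perp by auto
  qed (use dir par_int ord img in \<open>simp_all\<close>)
  then show ?thesis by (simp add: C_def)
qed

text \<open>Iterating \<open>N \<mapsto> 2 * N + 1\<close> from 0 yields \<open>2 ^ n - 1\<close>.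
  The minimum with \<open>g p\<close> lets short runs rest while long ones continue.\<close>

lemma runs_growth:
  assumes "\<delta> \<in> unit_dirs" "V \<noteq> {}" "free_runs \<delta> V g" and short: "\<And>p. p \<in> V \<Longrightarrow> g p < 2 ^ s"
  shows "(set_step ^^ s) V (V \<union> runs \<delta> V g)"
proof -
  have "(set_step ^^ n) V (V \<union> runs \<delta> V (\<lambda>p. min (g p) (2 ^ n - 1)))" for n
  proof (induction n)
    case 0
    then show ?case by (auto simp: runs_def)
  next
    case (Suc n)
    have "2 * (2 ^ n - 1) + 1 = (2 ^ Suc n - 1 :: nat)"
      by (cases "2 ^ n :: nat") auto
    then show ?case
      using relpowp_Suc_I[OF Suc runs_doubling_step[OF assms(1-3), of "2 ^ n - 1"]] by simp
  qed
  moreover have "runs \<delta> V (\<lambda>p. min (g p) (2 ^ s - 1)) = runs \<delta> V g"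
  proof -
    have "min (g p) (2 ^ s - 1) = g p" if "p \<in> V" for p using short[OF that] by auto
    then show ?thesis unfolding runs_def by (metis (no_types, lifting))
  qed
  ultimately show ?thesis by metis
qed

subsection \<open>Straight extensions\<close>

text \<open>Only membership of the cells in \<open>S\<close> is asked for, not edges: the closure
  joins consecutive cells in any case.\<close>

definition ext :: "pt set \<Rightarrow> pt \<Rightarrow> pt set \<Rightarrow> pt set" where
  "ext S \<delta> U = {along \<delta> u (int i) | u i. u \<in> U \<and> (\<forall>j. 1 \<le> j \<longrightarrow> j \<le> i \<longrightarrow> along \<delta> u (int j) \<in> S)}"

lemma ext_increasing: "U \<subseteq> ext S \<delta> U"
proof
  fix u assume "u \<in> U"
  then show "u \<in> ext S \<delta> U"
    unfolding ext_def by (intro CollectI exI[of _ u] exI[of _ "0::nat"]) simp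
qed

lemma ext_mono: "U \<subseteq> W \<Longrightarrow> ext S \<delta> U \<subseteq> ext S \<delta> W"
  unfolding ext_def by blast

lemma ext_subset: "U \<subseteq> S \<Longrightarrow> ext S \<delta> U \<subseteq> S"
proof
  fix q assume "U \<subseteq> S" "q \<in> ext S \<delta> U"
  then obtain u i where "q = along \<delta> u (int i)" "u \<in> U" "\<forall>j. 1 \<le> j \<longrightarrow> j \<le> i \<longrightarrow> along \<delta> u (int j) \<in> S"
    unfolding ext_def by blast
  then show "q \<in> S" using \<open>U \<subseteq> S\<close> by (cases "i = 0") auto
qed

lemma ext_step:
  assumes "q \<in> ext S \<delta> U" "along \<delta> q 1 \<in> S"
  shows "along \<delta> q 1 \<in> ext S \<delta> U"
proof -
  obtain u i where q: "q = along \<delta> u (int i)" "u \<in> U" "\<forall>j. 1 \<le> j \<longrightarrow> j \<le> i \<longrightarrow> along \<delta> u (int j) \<in> S"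
    using assms(1) unfolding ext_def by blast
  have eq: "along \<delta> q 1 = along \<delta> u (int (Suc i))" using q by (simp add: add.commute)
  show ?thesis unfolding ext_def
    using q assms(2) eq by (intro CollectI exI[of _ u] exI[of _ "Suc i"]) (auto simp: le_Suc_eq)
qed

text \<open>The two parities are filled in succession. The second half extends an already enlarged
  set, and idempotence ensures that it still ends at the extension of the original one.\<close>

lemma ext_idem: "ext S \<delta> (ext S \<delta> U) = ext S \<delta> U"
proof
  show "ext S \<delta> (ext S \<delta> U) \<subseteq> ext S \<delta> U"
  proof
    fix q assume "q \<in> ext S \<delta> (ext S \<delta> U)"
    then obtain u i where q: "q = along \<delta> u (int i)" "u \<in> ext S \<delta> U"
      "\<forall>j. 1 \<le> j \<longrightarrow> j \<le> i \<longrightarrow> along \<delta> u (int j) \<in> S"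
      unfolding ext_def[of S \<delta> "ext S \<delta> U"] by blast
    have "along \<delta> u (int j) \<in> ext S \<delta> U" if "j \<le> i" for j
      using that
    proof (induction j)
      case 0
      then show ?case using q by simp
    next
      case (Suc j)
      then show ?case using ext_step[of "along \<delta> u (int j)" S \<delta> U] q(3)[rule_format, of "Suc j"]
        by (simp add: add.commute)
    qed
    then show "q \<in> ext S \<delta> U" using q by simp
  qed
qed (rule ext_increasing)

section \<open>Filling the lines of one parity\<close>

lemma perpendicular_unit:
  assumes "\<delta> \<in> unit_dirs"
  shows "(- snd \<delta>, fst \<delta>) \<in> unit_dirs" "(snd \<delta>, - fst \<delta>) \<in> unit_dirs"
  using assms by (auto simp: unit_dirs_def)

text \<open>The direction \<open>(- snd \<delta>, fst \<delta>)\<close> is \<delta> turned by a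
  quarter; a unit step along it changes \<open>cross \<delta>\<close> by one and so flips the
  parity.\<close>

lemma perpendicular_neighbour:
  assumes "\<delta> \<in> unit_dirs" "grid_adj a b" "cross \<delta> a \<noteq> cross \<delta> b"
  shows "b = along (- snd \<delta>, fst \<delta>) a 1 \<or> b = along (- snd \<delta>, fst \<delta>) a (- 1)"
    and "even (cross \<delta> a) \<noteq> even (cross \<delta> b)"
proof -
  show *: "b = along (- snd \<delta>, fst \<delta>) a 1 \<or> b = along (- snd \<delta>, fst \<delta>) a (- 1)"
    using assms by (cases a; cases b) (auto simp: unit_dirs_def cross_def along_def grid_adj_def)
  have "even (cross \<delta> (along (- snd \<delta>, fst \<delta>) a i)) \<longleftrightarrow> even (cross \<delta> a + i)" for i
    using assms(1) by (auto simp: unit_dirs_def cross_def along_def)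
  then show "even (cross \<delta> a) \<noteq> even (cross \<delta> b)" using * by (elim disjE) auto
qed

text \<open>By parity, a perpendicular neighbour of a missing cell can only belong to \<open>U\<close>.\<close>
lemma half_ext_growth:
  assumes dir: "\<delta> \<in> unit_dirs" and "U \<noteq> {}" "U \<subseteq> S" "finite S" and s: "card S < 2 ^ s"
  shows "(set_step ^^ (2 + s)) U (U \<union> {q \<in> ext S \<delta> U. even (cross \<delta> q) = b})"
proof -
  define W where "W = U \<union> {q \<in> ext S \<delta> U. even (cross \<delta> q) = b}"
  define \<epsilon> where "\<epsilon> = (- snd \<delta>, fst \<delta>)"
  define \<epsilon>' where "\<epsilon>' = (snd \<delta>, - fst \<delta>)"
  \<comment> \<open>All operations of a step share one direction, so the two sides on which a
    missing cell can touch \<open>U\<close> need one step each.\<close>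
  define U1 where "U1 = U \<union> {q \<in> W. along \<epsilon> q (- 1) \<in> U}"
  define U2 where "U2 = U1 \<union> {q \<in> W. along \<epsilon> q 1 \<in> U}"
  have dirs: "\<epsilon> \<in> unit_dirs" "\<epsilon>' \<in> unit_dirs"
    using perpendicular_unit[OF dir] by (simp_all add: \<epsilon>_def \<epsilon>'_def)
  have opp: "along \<epsilon>' q (- 1) = along \<epsilon> q 1" for q
    by (simp add: along_def \<epsilon>_def \<epsilon>'_def)
  have 1: "set_step U U1"
    unfolding U1_def by (rule set_step_attach[OF dirs(1) \<open>U \<noteq> {}\<close>]) simp
  have 2: "set_step U1 U2"
    unfolding U2_def by (rule set_step_attach[OF dirs(2)]) (use \<open>U \<noteq> {}\<close> in \<open>auto simp: opp U1_def\<close>)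
  define R where "R = W - U2"
  have WS: "W \<subseteq> S" using ext_subset[OF \<open>U \<subseteq> S\<close>, of \<delta>] \<open>U \<subseteq> S\<close> by (auto simp: W_def)
  have U2W: "U \<subseteq> U2" "U2 \<subseteq> W" by (auto simp: U1_def U2_def W_def)
  have RS: "R \<subseteq> S" using WS by (auto simp: R_def)
  \<comment> \<open>Length of the block of \<open>R\<close> directly ahead of \<open>p\<close>, zero
    if the next cell is outside \<open>R\<close>. It exists because \<open>R\<close> lies in the
    finite set \<open>S\<close>, which also bounds it by \<open>card S\<close>.\<close>
  define g where "g p = (LEAST i. along \<delta> p (int (Suc i)) \<notin> R)" for p
  have ex: "\<exists>i. along \<delta> p (int (Suc i)) \<notin> R" for p
  proof (rule ccontr)
    assume "\<nexists>i. along \<delta> p (int (Suc i)) \<notin> R"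
    then have "range (\<lambda>i. along \<delta> p (int (Suc i))) \<subseteq> S" using WS by (auto simp: R_def)
    moreover have "inj (\<lambda>i. along \<delta> p (int (Suc i)))" by (intro injI) (simp add: along_inj[OF dir])
    ultimately show False using \<open>finite S\<close> finite_subset finite_imageD infinite_UNIV_nat by blast
  qed
  have g_end: "along \<delta> p (int (Suc (g p))) \<notin> R" for p
    unfolding g_def by (rule LeastI_ex[OF ex])
  have g_run: "along \<delta> p (int i) \<in> R" if i: "1 \<le> i" "i \<le> g p" for p i
  proof -
    have "i - 1 < g p" using i by simp
    then have "along \<delta> p (int (Suc (i - 1))) \<in> R" unfolding g_def using not_less_Least by blast
    then show ?thesis using i by simp
  qed
  have g_card: "g p < 2 ^ s" for p
  proof -
    have "inj_on (\<lambda>i. along \<delta> p (int i)) {1..g p}" by (intro inj_onI) (simp add: along_inj[OF dir])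
    moreover have "(\<lambda>i. along \<delta> p (int i)) ` {1..g p} \<subseteq> S"
      by (intro image_subsetI) (meson RS atLeastAtMost_iff g_run subsetD)
    ultimately have "card {1..g p} \<le> card S" using \<open>finite S\<close> by (rule card_inj_on_le)
    then show ?thesis using s by simp
  qed
  have runs_eq: "runs \<delta> U2 g = R"
  proof
    show "runs \<delta> U2 g \<subseteq> R" using g_run unfolding runs_def by blast
    show "R \<subseteq> runs \<delta> U2 g"
    proof
      fix q assume q: "q \<in> R"
      then have "q \<in> ext S \<delta> U" and par: "even (cross \<delta> q) = b"
        using U2W by (auto simp: R_def W_def)
      then obtain u i where u: "q = along \<delta> u (int i)" "u \<in> U"
        "\<forall>j. 1 \<le> j \<longrightarrow> j \<le> i \<longrightarrow> along \<delta> u (int j) \<in> S" unfolding ext_def by blast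
      \<comment> \<open>Walk back from \<open>q\<close> to the nearest node of \<open>U2\<close>.
        The cells passed lie on the same line inside the extension, hence in \<open>W\<close> but
        not in \<open>U2\<close>, so the block ahead of that node reaches \<open>q\<close>.\<close>
      define m where "m = (LEAST m. along \<delta> q (- int m) \<in> U2)"
      define p where "p = along \<delta> q (- int m)"
      have base: "along \<delta> q (- int i) \<in> U2" using u U2W by auto
      have pU: "p \<in> U2" unfolding p_def m_def by (rule LeastI[of "\<lambda>m. along \<delta> q (- int m) \<in> U2"]) (rule base)
      have "m \<le> i" unfolding m_def by (rule Least_le) (rule base)
      have "m \<noteq> 0" using pU q by (cases m) (simp_all add: p_def R_def)
      have in_R: "along \<delta> p (int j) \<in> R" if j: "1 \<le> j" "j \<le> m" for j
      proof -
        have "m - j < m" using j by simp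
        then have "along \<delta> q (- int (m - j)) \<notin> U2" using not_less_Least unfolding m_def by blast
        moreover have e: "along \<delta> p (int j) = along \<delta> q (- int (m - j))"
          using j by (simp add: p_def of_nat_diff)
        moreover have "along \<delta> p (int j) \<in> W"
        proof -
          have e2: "along \<delta> p (int j) = along \<delta> u (int (i - (m - j)))"
            using j \<open>m \<le> i\<close> by (simp add: p_def u of_nat_diff algebra_simps)
          have "along \<delta> p (int j) \<in> ext S \<delta> U"
            unfolding e2 ext_def using u by (intro CollectI exI[of _ u] exI[of _ "i - (m - j)"]) auto
          moreover have "cross \<delta> (along \<delta> p (int j)) = cross \<delta> q" by (simp add: p_def)
          ultimately show ?thesis using par by (simp add: W_def)
        qed
        ultimately show ?thesis by (simp add: R_def)
      qed
      have "m \<le> g p"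
      proof (rule ccontr)
        assume "\<not> m \<le> g p"
        then show False using in_R[of "Suc (g p)"] g_end[of p] by simp
      qed
      moreover have "q = along \<delta> p (int m)" by (simp add: p_def)
      ultimately show "q \<in> runs \<delta> U2 g" unfolding runs_def using pU \<open>m \<noteq> 0\<close>
        by (intro CollectI exI[of _ p] exI[of _ m]) simp
    qed
  qed
  have "free_runs \<delta> U2 g"
    unfolding free_runs_def runs_eq
  proof (intro conjI ballI impI)
    show "R \<inter> U2 = {}" by (auto simp: R_def)
    fix a b' assume a: "a \<in> R" and b': "b' \<in> U2 \<union> R" and adj: "grid_adj a b'"
    show "cross \<delta> a = cross \<delta> b'"
    proof (rule ccontr)
      assume ne: "cross \<delta> a \<noteq> cross \<delta> b'"
      have "even (cross \<delta> a) = b" using a U2W by (auto simp: R_def W_def)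
      moreover have "b' \<in> W" using b' U2W by (auto simp: R_def)
      ultimately have "b' \<in> U" using perpendicular_neighbour(2)[OF dir adj ne] by (auto simp: W_def)
      then have "a \<in> U2" using perpendicular_neighbour(1)[OF dir adj ne] a
        by (auto simp: U2_def U1_def R_def \<epsilon>_def)
      then show False using a by (simp add: R_def)
    qed
  qed
  then have "(set_step ^^ s) U2 (U2 \<union> runs \<delta> U2 g)"
    using runs_growth[OF dir] g_card U2W \<open>U \<noteq> {}\<close> by blast
  moreover have "U2 \<union> runs \<delta> U2 g = W" using U2W by (auto simp: runs_eq R_def)
  ultimately have "(set_step ^^ Suc (Suc s)) U W"
    using 1 2 relpowp_Suc_I2 by metis
  then show ?thesis by (simp add: W_def)
qed

lemma ext_growth:
  assumes "\<delta> \<in> unit_dirs" "U \<noteq> {}" "U \<subseteq> S" "finite S" "card S < 2 ^ s"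
  shows "(set_step ^^ (2 * (2 + s))) U (ext S \<delta> U)"
proof -
  define W where "W = U \<union> {q \<in> ext S \<delta> U. even (cross \<delta> q) = True}"
  have UW: "U \<subseteq> W" "W \<subseteq> ext S \<delta> U" using ext_increasing[of U] by (auto simp: W_def)
  then have W: "W \<noteq> {}" "W \<subseteq> S" using ext_subset[of U S \<delta>] assms by auto
  have "ext S \<delta> W = ext S \<delta> U"
    using ext_mono[OF UW(1)] ext_mono[OF UW(2)] ext_idem by blast
  then have "W \<union> {q \<in> ext S \<delta> W. even (cross \<delta> q) = False} = ext S \<delta> U"
    using UW by (auto simp: W_def)
  then have "(set_step ^^ (2 + s)) W (ext S \<delta> U)"
    using half_ext_growth[OF assms(1) W assms(4,5), of False] by simp
  moreover have "(set_step ^^ (2 + s)) U W"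
    unfolding W_def by (rule half_ext_growth[OF assms])
  ultimately have "(set_step ^^ ((2 + s) + (2 + s))) U (ext S \<delta> U)"
    unfolding relpowp_add by blast
  then show ?thesis by (simp add: mult_2)
qed

section \<open>Sweeps through the four directions\<close>

definition sweep :: "pt set \<Rightarrow> pt set \<Rightarrow> pt set" where
  "sweep S U = ext S (1, 0) (ext S (-1, 0) (ext S (0, 1) (ext S (0, -1) U)))"

lemma sweep_growth:
  assumes "U \<noteq> {}" "U \<subseteq> S" "finite S" "card S < 2 ^ s"
  shows "(set_step ^^ (8 * (2 + s))) U (sweep S U)"
proof -
  have *: "(set_step ^^ (n + 2 * (2 + s))) U (ext S \<delta> W)"
    if "(set_step ^^ n) U W" "U \<subseteq> W" "W \<subseteq> S" "\<delta> \<in> unit_dirs" for n W \<delta>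
  proof -
    have "(set_step ^^ (2 * (2 + s))) W (ext S \<delta> W)"
      using that assms by (intro ext_growth) auto
    then show ?thesis using that(1) unfolding relpowp_add by blast
  qed
  have inc: "U \<subseteq> ext S \<delta> W" if "U \<subseteq> W" for W \<delta> using ext_increasing that by blast
  have "(set_step ^^ ((((0 + 2 * (2 + s)) + 2 * (2 + s)) + 2 * (2 + s)) + 2 * (2 + s))) U (sweep S U)"
    unfolding sweep_def by (intro * inc ext_subset assms) (auto simp: unit_dirs_def)
  moreover have "8 * (2 + s) = (((0 + 2 * (2 + s)) + 2 * (2 + s)) + 2 * (2 + s)) + 2 * (2 + s)" by simp
  ultimately show ?thesis by metis
qed

text \<open>Earlier extensions only enlarge the argument and later ones only add cells, so the order
  of the four directions is immaterial.\<close>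

lemma ext_subset_sweep: "\<delta> \<in> unit_dirs \<Longrightarrow> ext S \<delta> U \<subseteq> sweep S U"
proof -
  assume "\<delta> \<in> unit_dirs"
  then consider "\<delta> = (1, 0)" | "\<delta> = (-1, 0)" | "\<delta> = (0, 1)" | "\<delta> = (0, -1)"
    by (auto simp: unit_dirs_def)
  then show ?thesis
    unfolding sweep_def
    by cases (simp_all, (meson ext_mono ext_increasing order_trans subset_refl)+)
qed

lemma sweep_increasing: "U \<subseteq> sweep S U"
  unfolding sweep_def by (meson ext_increasing order_trans)

lemma sweep_subset: "U \<subseteq> S \<Longrightarrow> sweep S U \<subseteq> S"
  unfolding sweep_def by (intro ext_subset)

lemma sweeps_growth:
  assumes "U \<noteq> {}" "U \<subseteq> S" "finite S" "card S < 2 ^ s"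
  shows "(set_step ^^ (m * (8 * (2 + s)))) U ((sweep S ^^ m) U) \<and> U \<subseteq> (sweep S ^^ m) U \<and> (sweep S ^^ m) U \<subseteq> S"
proof (induction m)
  case 0
  then show ?case using assms by simp
next
  case (Suc m)
  let ?W = "(sweep S ^^ m) U"
  have "(set_step ^^ (8 * (2 + s))) ?W (sweep S ?W)"
    using Suc assms by (intro sweep_growth) auto
  then have "(set_step ^^ (m * (8 * (2 + s)) + 8 * (2 + s))) U (sweep S ?W)"
    using Suc unfolding relpowp_add by blast
  moreover have "U \<subseteq> sweep S ?W" using Suc sweep_increasing by blast
  ultimately show ?case using Suc sweep_subset by (simp add: add.commute)
qed

subsection \<open>Turns and tree paths\<close>

abbreviation turn_at :: "pt list \<Rightarrow> nat \<Rightarrow> bool" where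
  "turn_at xs i \<equiv> (let a = psub (xs ! i) (xs ! (i - 1)); b = psub (xs ! Suc i) (xs ! i)
      in fst a * fst b + snd a * snd b = 0)"

lemma turns_append_le: "turns xs \<le> turns (xs @ ys)"
proof -
  have "{i. 0 < i \<and> Suc i < length xs \<and> turn_at xs i} \<subseteq>
        {i. 0 < i \<and> Suc i < length (xs @ ys) \<and> turn_at (xs @ ys) i}"
    by (auto simp: nth_append Let_def)
  moreover have "finite {i. 0 < i \<and> Suc i < length (xs @ ys) \<and> turn_at (xs @ ys) i}"
    by (rule finite_subset[of _ "{..length (xs @ ys)}"]) auto
  ultimately show ?thesis unfolding turns_def using card_mono by blast
qed

lemma turns_snoc_turn:
  assumes "length xs \<ge> 2" "turn_at (xs @ [v]) (length xs - 1)"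
  shows "turns xs < turns (xs @ [v])"
proof -
  have "{i. 0 < i \<and> Suc i < length xs \<and> turn_at xs i} \<subset>
        {i. 0 < i \<and> Suc i < length (xs @ [v]) \<and> turn_at (xs @ [v]) i}" (is "?A \<subset> ?B")
  proof
    show "?A \<subseteq> ?B" by (auto simp: nth_append Let_def)
    have "length xs - 1 \<in> ?B" "length xs - 1 \<notin> ?A" using assms by auto
    then show "?A \<noteq> ?B" by blast
  qed
  moreover have "finite {i. 0 < i \<and> Suc i < length (xs @ [v]) \<and> turn_at (xs @ [v]) i}"
    by (rule finite_subset[of _ "{..length (xs @ [v])}"]) auto
  ultimately show ?thesis unfolding turns_def using psubset_card_mono by blast
qed

lemma sweeps_mono: "m \<le> n \<Longrightarrow> (sweep S ^^ m) U \<subseteq> (sweep S ^^ n) U"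
  by (induction n rule: dec_induct) (use sweep_increasing in auto)

text \<open>Membership in the extension along the last edge is stronger than membership in the next
  sweep. It is the right induction invariant: going straight prolongs the same extension without
  another sweep, and only a turn, which raises \<open>turns\<close>, uses one up.\<close>

lemma path_last_in_ext:
  assumes "length xs \<ge> 2" "distinct xs" "set xs \<subseteq> S"
    "\<And>i. Suc i < length xs \<Longrightarrow> grid_adj (xs ! i) (xs ! Suc i)"
  shows "\<exists>\<delta>\<in>unit_dirs. last xs = along \<delta> (xs ! (length xs - 2)) 1 \<and>
     last xs \<in> ext S \<delta> ((sweep S ^^ turns xs) {hd xs})"
  using assms
proof (induction xs rule: rev_induct)
  case Nil
  then show ?case by simp
next
  case (snoc v xs)
  define q where "q = last xs"
  have xs: "xs \<noteq> []" using snoc.prems(1) by auto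
  have q: "xs ! (length xs - 1) = q" using xs by (simp add: q_def last_conv_nth)
  define \<delta>' where "\<delta>' = psub v q"
  have "grid_adj ((xs @ [v]) ! (length xs - 1)) ((xs @ [v]) ! Suc (length xs - 1))"
    using snoc.prems(4)[of "length xs - 1"] xs by simp
  then have "grid_adj q v" using xs q by (simp add: nth_append)
  then have dir': "\<delta>' \<in> unit_dirs"
    by (cases q; cases v) (auto simp: \<delta>'_def psub_def grid_adj_def unit_dirs_def)
  have v: "v = along \<delta>' q 1" by (simp add: \<delta>'_def psub_def along_def)
  have vS: "v \<in> S" using snoc.prems(3) by simp
  have prev: "(xs @ [v]) ! (length (xs @ [v]) - 2) = q"
    using xs q by (simp add: nth_append)
  have reduce: "?case" if "q \<in> (sweep S ^^ turns (xs @ [v])) {hd xs}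
      \<or> q \<in> ext S \<delta>' ((sweep S ^^ turns (xs @ [v])) {hd xs})"
  proof -
    have "q \<in> ext S \<delta>' ((sweep S ^^ turns (xs @ [v])) {hd xs})"
      using that ext_increasing by blast
    then have "v \<in> ext S \<delta>' ((sweep S ^^ turns (xs @ [v])) {hd xs})"
      using ext_step vS v by metis
    then show ?thesis using dir' v prev xs by (intro bexI[of _ \<delta>']) simp_all
  qed
  show ?case
  proof (cases "length xs \<ge> 2")
    case False
    then have "length xs = 1" using xs length_0_conv[of xs] by linarith
    then have "xs = [q]" using q by (auto simp: length_Suc_conv)
    then have "q \<in> (sweep S ^^ turns (xs @ [v])) {hd xs}"
      using sweeps_mono[of 0 "turns (xs @ [v])" S "{hd xs}"] by simp
    then show ?thesis by (rule reduce[OF disjI1])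
  next
    case True
    define p where "p = xs ! (length xs - 2)"
    have "grid_adj (xs ! i) (xs ! Suc i)" if "Suc i < length xs" for i
      using snoc.prems(4)[of i] that by (simp add: nth_append)
    then obtain \<delta> where dir: "\<delta> \<in> unit_dirs" and qp: "q = along \<delta> p 1"
      and qe: "q \<in> ext S \<delta> ((sweep S ^^ turns xs) {hd xs})"
      using snoc.IH[OF True] snoc.prems(2,3) by (auto simp: p_def q_def)
    have "p \<in> set xs" using True by (auto simp: p_def)
    then have "v \<noteq> p" using snoc.prems(2) by auto
    \<comment> \<open>Straight on, reversal, or right angle. A reversal would revisit
      \<open>p\<close>, against distinctness.\<close>
    consider "\<delta>' = \<delta>" | "\<delta>' = (- fst \<delta>, - snd \<delta>)" | "fst \<delta> * fst \<delta>' + snd \<delta> * snd \<delta>' = 0"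
      using dir dir' by (auto simp: unit_dirs_def)
    then show ?thesis
    proof cases
      case 1
      have "(sweep S ^^ turns xs) {hd xs} \<subseteq> (sweep S ^^ turns (xs @ [v])) {hd xs}"
        by (rule sweeps_mono[OF turns_append_le])
      then have "q \<in> ext S \<delta>' ((sweep S ^^ turns (xs @ [v])) {hd xs})"
        using qe ext_mono 1 by blast
      then show ?thesis by (rule reduce[OF disjI2])
    next
      case 2
      then have "v = p" using v qp by (simp add: along_def)
      then show ?thesis using \<open>v \<noteq> p\<close> by simp
    next
      case 3
      have "psub q p = \<delta>" using qp by (simp add: psub_def along_def)
      moreover have "(xs @ [v]) ! (length xs - 1) = q" "(xs @ [v]) ! (length xs - 1 - 1) = p"
        "(xs @ [v]) ! Suc (length xs - 1) = v"
        using q True xs by (auto simp: nth_append p_def numeral_2_eq_2)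
      ultimately have "turn_at (xs @ [v]) (length xs - 1)"
        using 3 by (simp add: Let_def \<delta>'_def)
      then have "Suc (turns xs) \<le> turns (xs @ [v])" by (intro Suc_leI turns_snoc_turn[OF True])
      moreover have "q \<in> (sweep S ^^ Suc (turns xs)) {hd xs}"
        using qe ext_subset_sweep[OF dir] by auto
      ultimately have "q \<in> (sweep S ^^ turns (xs @ [v])) {hd xs}"
        using sweeps_mono by blast
      then show ?thesis by (rule reduce[OF disjI1])
    qed
  qed
qed

section \<open>Simple paths in the spanning tree and their extension to leaves\<close>

lemma tree_path_snoc:
  assumes "tree_path T xs" "{last xs, z} \<in> T" "z \<notin> set xs"
  shows "tree_path T (xs @ [z])"
  unfolding tree_path_def
proof (intro conjI allI impI)
  show "distinct (xs @ [z])" using assms by (simp add: tree_path_def)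
  fix i assume i: "Suc i < length (xs @ [z])"
  show "{(xs @ [z]) ! i, (xs @ [z]) ! Suc i} \<in> T"
  proof (cases "Suc i < length xs")
    case True
    then show ?thesis using assms(1) by (simp add: tree_path_def nth_append)
  next
    case False
    then have "i = length xs - 1" "xs \<noteq> []" "Suc i = length xs" using i assms(1) by (auto simp: tree_path_def)
    then show ?thesis using assms(2) by (simp add: nth_append last_conv_nth)
  qed
qed simp

lemma tree_path_take:
  assumes "tree_path T xs" "0 < n"
  shows "tree_path T (take n xs)"
  using assms by (auto simp: tree_path_def)

lemma tree_path_exists:
  assumes "(p, q) \<in> (edge_rel T)\<^sup>*"
  shows "\<exists>xs. tree_path T xs \<and> hd xs = p \<and> last xs = q"
  using assms
proof (induction rule: rtrancl_induct)
  case base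
  show ?case by (intro exI[of _ "[p]"]) (simp add: tree_path_def)
next
  case (step y z)
  then obtain xs where xs: "tree_path T xs" "hd xs = p" "last xs = y" by blast
  have ne: "xs \<noteq> []" using xs by (simp add: tree_path_def)
  show ?case
  proof (cases "z \<in> set xs")
    case False
    then have "tree_path T (xs @ [z])" using tree_path_snoc xs step(2) by (simp add: edge_rel_def)
    then show ?thesis using xs ne by (intro exI[of _ "xs @ [z]"]) simp
  next
    case True
    \<comment> \<open>A walk that returns to its path is cut back to the node it meets.\<close>
    then obtain i where i: "i < length xs" "xs ! i = z" by (auto simp: in_set_conv_nth)
    then have "tree_path T (take (Suc i) xs)" "hd (take (Suc i) xs) = p" "last (take (Suc i) xs) = z"
      using tree_path_take[OF xs(1), of "Suc i"] xs ne by (auto simp: take_Suc_conv_app_nth hd_append hd_conv_nth)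
    then show ?thesis by blast
  qed
qed

lemma tree_path_set:
  assumes "tree_path T xs" "hd xs \<in> V" "\<And>e. e \<in> T \<Longrightarrow> e \<subseteq> V"
  shows "set xs \<subseteq> V"
proof
  fix x assume "x \<in> set xs"
  then obtain i where i: "i < length xs" "xs ! i = x" by (auto simp: in_set_conv_nth)
  show "x \<in> V"
  proof (cases i)
    case 0
    then show ?thesis using i assms(1,2) by (auto simp: tree_path_def hd_conv_nth)
  next
    case (Suc j)
    then have "{xs ! j, xs ! Suc j} \<in> T" using i assms(1) unfolding tree_path_def by blast
    then show ?thesis using assms(3) i Suc by blast
  qed
qed

lemma tree_path_connected_avoiding:
  assumes xs: "tree_path T xs" and ij: "i \<le> j" "j < length xs"
    and e: "\<And>l. i \<le> l \<Longrightarrow> l < j \<Longrightarrow> {xs ! l, xs ! Suc l} \<noteq> e"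
  shows "(xs ! i, xs ! j) \<in> (edge_rel (T - {e}))\<^sup>*"
  using ij e
proof (induction j rule: dec_induct)
  case base
  then show ?case by simp
next
  case (step j)
  then have "(xs ! j, xs ! Suc j) \<in> edge_rel (T - {e})"
    using xs by (simp add: edge_rel_def tree_path_def)
  moreover have "(xs ! i, xs ! j) \<in> (edge_rel (T - {e}))\<^sup>*" using step by simp
  ultimately show ?case by (rule rtrancl_into_rtrancl[rotated])
qed

text \<open>By maximality, a second edge at the last node would lead back to an earlier node of the
  path. The part of the path in between joins the ends of that edge without using it, against the
  acyclicity of the tree.\<close>

lemma maximal_tree_path_leaf:
  assumes tree: "spanning_tree S T" and shp: "is_shape S"
    and xs: "tree_path T xs" "hd xs = r" "length xs \<ge> 2"
    and maximal: "\<And>z. \<not> tree_path T (xs @ [z])"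
  shows "is_leaf T r (last xs)"
proof -
  define w where "w = last xs"
  define n where "n = length xs"
  have d: "distinct xs" "xs \<noteq> []" using xs by (auto simp: tree_path_def)
  have w: "w = xs ! (n - 1)" using d by (simp add: w_def n_def last_conv_nth)
  define p where "p = xs ! (n - 2)"
  have "{xs ! (n - 2), xs ! Suc (n - 2)} \<in> T" using xs unfolding tree_path_def n_def by simp
  moreover have "Suc (n - 2) = n - 1" using xs by (simp add: n_def)
  ultimately have pw: "{p, w} \<in> T" by (simp add: p_def w)
  have "w \<noteq> r" using d xs(2,3) w nth_eq_iff_index_eq[of xs "n - 1" 0] by (auto simp: hd_conv_nth n_def)
  have only: "e = {p, w}" if e: "e \<in> T" "w \<in> e" for e
  proof (rule ccontr)
    assume ne: "e \<noteq> {p, w}"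
    have "e \<in> snd S" using tree e by (auto simp: spanning_tree_def)
    then obtain z where z: "e = {w, z}" "w \<noteq> z"
      using shp e(2) unfolding is_shape_def grid_adj_def by (fastforce simp: insert_commute)
    have "z \<in> set xs" using tree_path_snoc[OF xs(1), of z] maximal e(1) z by (auto simp: w_def)
    then obtain i where i: "i < n" "xs ! i = z" by (auto simp: in_set_conv_nth n_def)
    have "i \<noteq> n - 1" "i \<noteq> n - 2" using i z ne w by (auto simp: p_def insert_commute)
    have "(xs ! i, xs ! (n - 1)) \<in> (edge_rel (T - {e}))\<^sup>*"
    proof (rule tree_path_connected_avoiding[OF xs(1)])
      show "i \<le> n - 1" "n - 1 < length xs" using i xs by (auto simp: n_def)
      fix l assume l: "i \<le> l" "l < n - 1"
      have "w \<noteq> xs ! l" using l w d nth_eq_iff_index_eq[of xs "n - 1" l] by (auto simp: n_def)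
      moreover have "l = n - 2" if "w = xs ! Suc l"
      proof -
        have "n - 1 < length xs" "Suc l < length xs" using l by (auto simp: n_def)
        then have "n - 1 = Suc l" using that w d nth_eq_iff_index_eq[of xs "n - 1" "Suc l"] by simp
        then show ?thesis by simp
      qed
      moreover have "xs ! l = z \<Longrightarrow> l = i" using i l d nth_eq_iff_index_eq[of xs l i] by (auto simp: n_def)
      ultimately show "{xs ! l, xs ! Suc l} \<noteq> e"
        using \<open>i \<noteq> n - 2\<close> z by (auto simp: doubleton_eq_iff)
    qed
    then have "(z, w) \<in> (edge_rel (T - {e}))\<^sup>*" using i w by simp
    moreover have "e = {z, w}" using z by auto
    ultimately show False using tree e(1) unfolding spanning_tree_def by blast
  qed
  have "{e \<in> T. w \<in> e} = {{p, w}}" using only pw by blast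
  then show ?thesis using \<open>w \<noteq> r\<close> by (simp add: is_leaf_def w_def)
qed

text \<open>The class bounds turns only on root-to-leaf paths; this transfers the bound to prefixes,
  hence to all nodes. A longest extension exists because a simple path has at most
  \<open>card (fst S)\<close> nodes.\<close>

lemma tree_path_extends_to_leaf:
  assumes tree: "spanning_tree S T" and shp: "is_shape S" and r: "r \<in> fst S"
    and xs: "tree_path T xs" "hd xs = r" "length xs \<ge> 2"
  shows "\<exists>ys. tree_path T (xs @ ys) \<and> is_leaf T r (last (xs @ ys))"
proof -
  have TV: "e \<subseteq> fst S" if "e \<in> T" for e
    using that tree shp unfolding spanning_tree_def is_shape_def by blast
  have fin: "finite (fst S)" using shp by (simp add: is_shape_def)
  have bound: "length zs \<le> card (fst S)" if "tree_path T zs" "hd zs = r" for zs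
  proof -
    have "set zs \<subseteq> fst S" using tree_path_set[OF that(1)] that(2) r TV by blast
    then have "card (set zs) \<le> card (fst S)" using fin by (rule card_mono[rotated])
    then show ?thesis using that(1) by (simp add: tree_path_def distinct_card)
  qed
  have ne: "xs \<noteq> []" using xs(3) by auto
  define P where "P m \<longleftrightarrow> (\<exists>ys. tree_path T (xs @ ys) \<and> length ys = m)" for m
  have "P 0" using xs(1) by (simp add: P_def)
  have P_bound: "m \<le> card (fst S)" if "P m" for m
    using that bound xs(2) ne unfolding P_def by fastforce
  define m where "m = Greatest P"
  have m: "P m" "m' \<le> m" if "P m'" for m'
    unfolding m_def using \<open>P 0\<close> that P_bound by (blast intro: GreatestI_nat Greatest_le_nat)+
  from m(1)[OF \<open>P 0\<close>]
  obtain ys where ys: "tree_path T (xs @ ys)" "length ys = m" by (auto simp: P_def)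
  have "\<not> tree_path T ((xs @ ys) @ [z])" for z
  proof
    assume "tree_path T ((xs @ ys) @ [z])"
    then have "P (Suc m)" using ys(2) unfolding P_def by (intro exI[of _ "ys @ [z]"]) simp
    then show False using m(2)[of "Suc m"] by simp
  qed
  then have "is_leaf T r (last (xs @ ys))"
    using maximal_tree_path_leaf[OF tree shp ys(1)] xs ne by simp
  then show ?thesis using ys(1) by blast
qed

text \<open>A path with at most \<open>k\<close> turns has at most \<open>k + 1\<close> straight
  segments, and each is covered by one sweep.\<close>

lemma in_Ck_sweeps:
  assumes shp: "is_shape S" and "in_Ck k S"
  obtains r where "r \<in> fst S" "(sweep (fst S) ^^ Suc k) {r} = fst S"
proof -
  obtain T r where tree: "spanning_tree S T" and r: "r \<in> fst S"
    and turns: "\<And>xs. tree_path T xs \<Longrightarrow> hd xs = r \<Longrightarrow> is_leaf T r (last xs) \<Longrightarrow> turns xs \<le> k"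
    using assms(2) unfolding in_Ck_def by blast
  have adj: "grid_adj a b" if "{a, b} \<in> T" for a b
  proof -
    have "{a, b} \<in> snd S" using that tree by (auto simp: spanning_tree_def)
    then obtain p q where "{a, b} = {p, q}" "grid_adj p q" using shp unfolding is_shape_def by blast
    then show ?thesis using grid_adj_sym unfolding doubleton_eq_iff by blast
  qed
  have TV: "e \<subseteq> fst S" if "e \<in> T" for e
    using that tree shp unfolding spanning_tree_def is_shape_def by blast
  have "v \<in> (sweep (fst S) ^^ Suc k) {r}" if v: "v \<in> fst S" for v
  proof (cases "v = r")
    case True
    then show ?thesis using sweeps_mono[of 0 "Suc k" "fst S" "{r}"] by auto
  next
    case False
    have "(r, v) \<in> (edge_rel T)\<^sup>*" using tree r v by (simp add: spanning_tree_def)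
    then obtain xs where xs: "tree_path T xs" "hd xs = r" "last xs = v"
      using tree_path_exists by blast
    have len: "length xs \<ge> 2"
    proof (rule ccontr)
      assume "\<not> 2 \<le> length xs"
      moreover have "xs \<noteq> []" using xs by (simp add: tree_path_def)
      ultimately have "length xs = 1" using length_0_conv[of xs] by linarith
      then show False using xs False by (auto simp: length_Suc_conv)
    qed
    obtain ys where ys: "tree_path T (xs @ ys)" "is_leaf T r (last (xs @ ys))"
      using tree_path_extends_to_leaf[OF tree shp r xs(1,2) len] by blast
    have "hd (xs @ ys) = r" using xs len by (cases xs) auto
    then have "turns xs \<le> k" using turns[OF ys(1) _ ys(2)] turns_append_le order_trans by blast
    have "set xs \<subseteq> fst S" using tree_path_set[OF xs(1)] xs(2) r TV by blast
    then obtain \<delta> where "\<delta> \<in> unit_dirs" "v \<in> ext (fst S) \<delta> ((sweep (fst S) ^^ turns xs) {r})"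
      using path_last_in_ext[OF len, of "fst S"] xs adj by (auto simp: tree_path_def)
    then have "v \<in> (sweep (fst S) ^^ Suc (turns xs)) {r}" by (simp add: subsetD[OF ext_subset_sweep])
    then show ?thesis using sweeps_mono[of "Suc (turns xs)" "Suc k"] \<open>turns xs \<le> k\<close> by blast
  qed
  moreover have "(sweep (fst S) ^^ m) {r} \<subseteq> fst S" for m
    using r sweep_subset by (induction m) auto
  ultimately show thesis using that[OF r] by blast
qed

subsection \<open>Translation and step count\<close>

text \<open>Sweeps start at the root of the tree, while the process starts at the origin;
  translating every step reconciles the two.\<close>

lemma set_step_translate:
  assumes "set_step V V'"
  shows "set_step ((\<lambda>p. padd p c) ` V) ((\<lambda>p. padd p c) ` V')"
proof -
  obtain \<delta> A d where dir: "\<delta> \<in> unit_dirs" and A: "A \<subseteq> V" and anchor: "\<exists>u\<in>V. d u = 0"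
    and par: "\<forall>a\<in>V. along \<delta> a 1 \<in> V \<longrightarrow> d (along \<delta> a 1) = d a + of_bool (a \<in> A)"
    and perp: "\<forall>a\<in>V. \<forall>b\<in>V. grid_adj a b \<longrightarrow> cross \<delta> a \<noteq> cross \<delta> b \<longrightarrow> d a = d b"
    and ord: "\<forall>a\<in>V. \<forall>j\<ge>1. along \<delta> a j \<in> V \<longrightarrow> d a + of_bool (a \<in> A) < j + d (along \<delta> a j)"
    and V': "V' = (\<lambda>a. along \<delta> a (d a)) ` V \<union> (\<lambda>a. along \<delta> a (d a + 1)) ` A"
    using assms unfolding set_step_def by (elim exE conjE) (rule that; assumption)
  define \<tau> where "\<tau> = (\<lambda>p. padd p c)"
  define d' where "d' = (\<lambda>p. d (psub p c))"
  have d': "d' (\<tau> p) = d p" for p by (simp add: d'_def \<tau>_def psub_def padd_def)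
  have inj: "inj \<tau>" by (rule injI) (simp add: \<tau>_def padd_def prod_eq_iff)
  have along: "along \<delta> (\<tau> p) i = \<tau> (along \<delta> p i)" for p i
    by (simp add: \<tau>_def padd_def along_def)
  have cross: "cross \<delta> (\<tau> p) = cross \<delta> p + cross \<delta> c" for p
    by (simp add: \<tau>_def padd_def cross_def algebra_simps)
  have adj: "grid_adj (\<tau> p) (\<tau> q) = grid_adj p q" for p q
    by (simp add: \<tau>_def padd_def grid_adj_def)
  have "set_step (\<tau> ` V) (\<tau> ` V')"
    unfolding set_step_def
  proof (rule exI[of _ \<delta>], rule exI[of _ "\<tau> ` A"], rule exI[of _ d'], intro conjI)
    show "\<tau> ` V' = (\<lambda>a. along \<delta> a (d' a)) ` \<tau> ` V \<union> (\<lambda>a. along \<delta> a (d' a + 1)) ` \<tau> ` A"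
      by (simp add: V' image_Un image_image along d')
  qed (use dir A anchor par perp ord in
      \<open>simp_all add: ball_simps bex_simps along d' cross adj inj_image_mem_iff[OF inj] image_mono\<close>)
  then show ?thesis by (simp add: \<tau>_def)
qed

lemma set_steps_translate:
  "(set_step ^^ n) V V' \<Longrightarrow> (set_step ^^ n) ((\<lambda>p. padd p c) ` V) ((\<lambda>p. padd p c) ` V')"
proof (induction n arbitrary: V')
  case 0
  then show ?case by simp
next
  case (Suc n)
  from Suc.prems obtain W where "(set_step ^^ n) V W" "set_step W V'" by (rule relpowp_Suc_E)
  then show ?case using relpowp_Suc_I[OF Suc.IH set_step_translate] by blast
qed

lemma shift_full: "shift c (full V) = full ((\<lambda>p. padd p c) ` V)"
proof -
  define \<tau> where "\<tau> = (\<lambda>p. padd p c)"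
  have adj: "grid_adj (\<tau> p) (\<tau> q) = grid_adj p q" for p q
    by (simp add: \<tau>_def padd_def grid_adj_def)
  have "(\<lambda>e. \<tau> ` e) ` {{p, q} | p q. p \<in> V \<and> q \<in> V \<and> grid_adj p q} =
        {{p, q} | p q. p \<in> \<tau> ` V \<and> q \<in> \<tau> ` V \<and> grid_adj p q}" (is "?L = ?R")
  proof
    show "?L \<subseteq> ?R"
    proof
      fix e assume "e \<in> ?L"
      then obtain p q where "e = {\<tau> p, \<tau> q}" "p \<in> V" "q \<in> V" "grid_adj p q" by auto
      then show "e \<in> ?R" using adj by blast
    qed
    show "?R \<subseteq> ?L"
    proof
      fix e assume "e \<in> ?R"
      then obtain p q where pq: "e = {\<tau> p, \<tau> q}" "p \<in> V" "q \<in> V" "grid_adj (\<tau> p) (\<tau> q)" by blast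
      then show "e \<in> ?L" using adj by (intro image_eqI[of _ _ "{p, q}"]) auto
    qed
  qed
  then show ?thesis by (simp add: shift_def full_def \<tau>_def)
qed

lemma AC_eq_full: "is_shape S \<Longrightarrow> AC S = full (fst S)"
  unfolding is_shape_def AC_def full_def by (simp add: Un_absorb1)

lemma single_node_eq_full: "single_node = full {(0, 0)}"
  by (auto simp: single_node_def full_def grid_adj_def)

lemma set_steps_grows_in:
  assumes "(set_step ^^ n) {r} V"
  shows "grows_in single_node (full V) n"
proof -
  define c where "c = psub (0, 0) r"
  have "(set_step ^^ n) {(0, 0)} ((\<lambda>p. padd p c) ` V)"
    using set_steps_translate[OF assms, of c] by (simp add: c_def padd_def psub_def)
  then obtain f where f: "f 0 = {(0, 0)}" "f n = (\<lambda>p. padd p c) ` V" "\<forall>i<n. set_step (f i) (f (Suc i))"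
    unfolding relpowp_fun_conv by blast
  have "(\<lambda>p. padd p r) ` (\<lambda>p. padd p c) ` V = V"
    by (simp add: image_image c_def padd_def psub_def)
  then have "congruent_shape (full (f n)) (full V)"
    unfolding congruent_shape_def by (intro exI[of _ r]) (simp add: f shift_full)
  moreover have "\<exists>Se. growth_step (full (f t)) Se \<and> full (f (Suc t)) = AC Se" if t: "t < n" for t
  proof -
    obtain Se where "growth_step (full (f t)) Se" "AC Se = full (f (Suc t))"
      by (rule set_step_growth_step) (use f(3) t in blast)
    then show ?thesis by metis
  qed
  ultimately show ?thesis
    unfolding grows_in_def by (intro exI[of _ "\<lambda>t. full (f t)"]) (simp add: f single_node_eq_full)
qed

text \<open>The constant is \<open>2 * 8 * 8\<close>: \<open>k + 1 \<le> 2 * k\<close>, the factor 8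
  of a sweep, and \<open>3 + m \<le> 8 * ln n\<close>. The last holds because
  \<open>ln 2 \<ge> 1 / 2\<close> gives \<open>m \<le> 2 * ln n\<close> and, for
  \<open>n \<ge> 2\<close>, \<open>3 \<le> 6 * ln n\<close>.\<close>

lemma sweep_count_bound:
  fixes k m n :: nat
  assumes "k \<ge> 1" "n \<ge> 2" "2 ^ m \<le> n"
  shows "real (Suc k * (8 * (2 + Suc m))) \<le> 128 * real k * ln (real n)"
proof -
  \<comment> \<open>From \<open>ln x \<le> x - 1\<close> at \<open>x = 1 / 2\<close>.\<close>
  have ln2: "ln 2 \<ge> (1 / 2 :: real)"
    using ln_le_minus_one[of "1 / 2 :: real"] by (simp add: ln_div)
  have "real (2 ^ m) \<le> real n" using assms(3) by (rule of_nat_mono)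
  then have "ln (2 ^ m) \<le> ln (real n)" using assms(2) by (intro ln_mono) simp_all
  moreover have "real m * ln 2 = ln (2 ^ m)" by (simp add: ln_realpow)
  ultimately have "real m * ln 2 \<le> ln (real n)" by simp
  moreover have "real m * (1 / 2) \<le> real m * ln 2" using ln2 by (intro mult_left_mono) auto
  ultimately have m: "real m \<le> 2 * ln (real n)" by simp
  have "ln 2 \<le> ln (real n)" using assms by simp
  then have "3 + real m \<le> 8 * ln (real n)" using m ln2 by simp
  then have "real (Suc k) * (8 * (3 + real m)) \<le> (2 * real k) * (8 * (8 * ln (real n)))"
    using assms by (intro mult_mono) auto
  then show ?thesis by (simp add: algebra_simps)
qed

theorem theorem4p1:
  shows "\<exists>c::real. c > 0 \<and>
    (\<forall>k::nat. \<forall>S::shape. k \<ge> 1 \<longrightarrow> is_shape S \<longrightarrow> in_Ck k S \<longrightarrow>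
       (\<exists>tf::nat. real tf \<le> c * real k * ln (real (card (fst S))) \<and>
                  grows_in single_node (AC S) tf))"
proof (intro exI[of _ "128::real"] conjI allI impI)
  fix k :: nat and S :: shape
  assume k: "k \<ge> 1" and shp: "is_shape S" and Ck: "in_Ck k S"
  define n where "n = card (fst S)"
  have fin: "finite (fst S)" and "fst S \<noteq> {}" using shp by (auto simp: is_shape_def)
  then have "n \<ge> 1" by (simp add: n_def Suc_leI card_gt_0_iff)
  show "\<exists>tf::nat. real tf \<le> 128 * real k * ln (real (card (fst S))) \<and> grows_in single_node (AC S) tf"
  \<comment> \<open>For one node the logarithm vanishes, so not a single step is allowed.\<close>
  proof (cases "n = 1")
    case True
    then obtain r where "fst S = {r}" by (auto simp: n_def card_1_singleton_iff)
    then have "grows_in single_node (AC S) 0"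
      using set_steps_grows_in[of 0 r "{r}"] AC_eq_full[OF shp] by simp
    then show ?thesis using True by (intro exI[of _ 0]) (simp add: n_def)
  next
    case False
    then have n: "n \<ge> 2" using \<open>n \<ge> 1\<close> by simp
    \<comment> \<open>Here \<open>m\<close> is the binary logarithm of \<open>n\<close> rounded
      down; the sweeps need a power strictly above \<open>n\<close>, hence the exponent
      \<open>Suc m\<close>.\<close>
    obtain m where m: "2 ^ m \<le> n" "n < 2 ^ (m + 1)"
      using ex_power_ivl1[of 2 n] \<open>n \<ge> 1\<close> by auto
    obtain r where r: "r \<in> fst S" "(sweep (fst S) ^^ Suc k) {r} = fst S"
      using in_Ck_sweeps[OF shp Ck] by blast
    have "(set_step ^^ (Suc k * (8 * (2 + Suc m)))) {r} ((sweep (fst S) ^^ Suc k) {r})"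
      using sweeps_growth[of "{r}" "fst S" "Suc m" "Suc k"] r(1) fin m(2) by (simp add: n_def)
    then have "grows_in single_node (AC S) (Suc k * (8 * (2 + Suc m)))"
      using set_steps_grows_in AC_eq_full[OF shp] r(2) by simp
    then show ?thesis using sweep_count_bound[OF k n m(1)] unfolding n_def by blast
  qed
qed simp

end
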